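(* Let $m\ge 1$ be an integer and $h>0$ a real number, and let $D_m[\beta]$, $\beta\in\mathbb{Z}$, be the discrete analogue of the differential operator $\frac{d^{2m}}{dx^{2m}}$. Then for every real $p$, $$ \sum_{\beta\in\mathbb{Z}}D_m[\beta]\exp(2\pi i h p\beta)=\frac{(-1)^m2^{2m}(2m-1)!\,h^{-2m}\sin^{2m}(\pi h p)}{2\sum\limits_{k=0}^{m-2}a_k^{(2m-2)}\cos\bigl(2\pi h p(m-1-k)\bigr)+a_{m-1}^{(2m-2)}}, $$ where $$ a_k^{(2m-2)}=\sum_{j=0}^{k}(-1)^j\binom{2m}{j}(k+1-j)^{2m-1} $$ are the coefficients of the Euler polynomial $E_{2m-2}(\lambda)=\sum_{k=0}^{2m-2}a_k^{(2m-2)}\lambda^k$.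
   Context: Euler polynomials: for an integer $k\ge 0$, $E_k(\lambda)$ is the polynomial of degree $k$ defined by $\lambda E_k(\lambda)=(1-\lambda)^{k+2}D^k\frac{\lambda}{(1-\lambda)^2}$, where $D=\lambda\frac{d}{d\lambda}$ and $D^k=\lambda\frac{d}{d\lambda}D^{k-1}$ (these are the Euler-Frobenius polynomials, e.g. $E_0=1$, $E_1=\lambda+1$, $E_2=\lambda^2+4\lambda+1$). It is known that $E_k(\lambda)=\sum_{s=0}^k a_s^{(k)}\lambda^s$ with $a_s^{(k)}=\sum_{j=0}^s(-1)^j\binom{k+2}{j}(s+1-j)^{k+1}$, and (Frobenius) that all $k$ roots of $E_k$ are real, negative and distinct, $\lambda_1^{(k)}<\dots<\lambda_k^{(k)}<0$, with $\lambda_j^{(k)}\lambda_{k+1-j}^{(k)}=1$. Functions of discrete argument are functions on $\mathbb{Z}$; $h>0$ is the lattice step. Put $G_m[\beta]=\frac{(h\beta)^{2m-1}\operatorname{sign}(h\beta)}{2\,(2m-1)!}$, and $\delta[\beta]=1$ if $\beta=0$, $\delta[\beta]=0$ otherwise. Convolution is $\varphi[\beta]*\psi[\beta]=\sum_{\gamma\in\mathbb{Z}}\varphi[\gamma]\psi[\beta-\gamma]$. The discrete analogue of $d^{2m}/dx^{2m}$ is the function $D_m:\mathbb{Z}\to\mathbb{R}$ such that $h\,D_m[\beta]*G_m[\beta]=\delta[\beta]$ for all $\beta\in\mathbb{Z}$, where the convolution series are required to converge absolutely. Empty sums are zero. *)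

theory Defs
  imports "HOL-Analysis.Analysis" "HOL-Computational_Algebra.Polynomial"
begin

definition theta_op :: "(real \<Rightarrow> real) \<Rightarrow> real \<Rightarrow> real" where
  "theta_op f = (\<lambda>x. x * deriv f x)"

(* The point x = 1 is excluded: there x / (1 - x)^2 has a pole, which HOL totalizes to 0. *)
definition euler_poly :: "nat \<Rightarrow> real poly" where
  "euler_poly k = (THE P. degree P = k \<and>
     (\<forall>x. x \<noteq> 1 \<longrightarrow>
        x * poly P x = (1 - x) ^ (k + 2) * (theta_op ^^ k) (\<lambda>t. t / (1 - t)\<^sup>2) x))"

definition discrete_G :: "nat \<Rightarrow> real \<Rightarrow> int \<Rightarrow> real" where
  "discrete_G m h \<beta> =
     (h * real_of_int \<beta>) ^ (2 * m - 1) * sgn (h * real_of_int \<beta>) / (2 * fact (2 * m - 1))"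

definition discrete_delta :: "int \<Rightarrow> real" where
  "discrete_delta \<beta> = (if \<beta> = 0 then 1 else 0)"

definition discrete_conv :: "(int \<Rightarrow> real) \<Rightarrow> (int \<Rightarrow> real) \<Rightarrow> int \<Rightarrow> real" where
  "discrete_conv \<phi> \<psi> \<beta> = (\<Sum>\<^sub>\<infinity>\<gamma>\<in>UNIV. \<phi> \<gamma> * \<psi> (\<beta> - \<gamma>))"

definition discrete_analogue :: "nat \<Rightarrow> real \<Rightarrow> (int \<Rightarrow> real) \<Rightarrow> bool" where
  "discrete_analogue m h D \<longleftrightarrow>
     (\<forall>\<beta>. (\<lambda>\<gamma>. \<bar>D \<gamma> * discrete_G m h (\<beta> - \<gamma>)\<bar>) summable_on UNIV \<and>
          h * discrete_conv D (discrete_G m h) \<beta> = discrete_delta \<beta>)"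

end

(* A central difference of order 2m turns G_m into the finitely supported sequence
   h^(2m-1)/(2m-1)! * a_s at s + 1 - m, so the convolution equation for D becomes a finite
   difference equation. D is absolutely summable because G_m is bounded away from 0 off the origin,
   and taking Fourier series of the difference equation gives, with z = exp(2 pi i h p),
     S(p) * h^(2m)/(2m-1)! * z^(1-m) E_(2m-2)(z) = (-4 sin^2(pi h p))^m.
   The existence of D makes the denominator nonzero wherever the right-hand side is; at z = 1 it is
   E_(2m-2)(1) = (2m-1)!. *)
theory Submission
  imports Defs
begin

section \<open>Euler polynomials through a recurrence\<close>

text \<open>The recurrence records what one application of \<open>theta_op\<close> does to x E(x) /
  (1 - x)^(k + 2): by the quotient rule the result is x ((1 - x) (x E)' + (k + 2) x E) / (1 - x)^(k
  + 3). Here \<open>pCons 0\<close> is multiplication by x.\<close>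

primrec euler_frobenius :: "nat \<Rightarrow> real poly" where
  "euler_frobenius 0 = 1"
| "euler_frobenius (Suc k) = [:1, -1:] * pderiv (pCons 0 (euler_frobenius k))
     + smult (real (k + 2)) (pCons 0 (euler_frobenius k))"

text \<open>At 1 the term carrying 1 - x drops out, so each step multiplies the value by k + 2. This
  value is the denominator at the zeros of the sine.\<close>

lemma poly_euler_frobenius_1: "poly (euler_frobenius k) 1 = fact (k + 1)"
  by (induction k) (simp_all add: algebra_simps)

lemma coeff_euler_frobenius_Suc_0: "coeff (euler_frobenius (Suc k)) 0 = coeff (euler_frobenius k) 0"
  by (simp add: pderiv_pCons coeff_pCons)

text \<open>The recurrence of the Eulerian triangle; the degree, the leading coefficient and the
  symmetry follow from it by induction.\<close>

lemma coeff_euler_frobenius_Suc_Suc: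
  "coeff (euler_frobenius (Suc k)) (Suc s) =
     (real s + 2) * coeff (euler_frobenius k) (Suc s)
     + (real k + 1 - real s) * coeff (euler_frobenius k) s"
  by (cases s) (simp_all add: coeff_pderiv coeff_pCons algebra_simps)

lemma coeff_euler_frobenius_0: "coeff (euler_frobenius k) 0 = 1"
  by (induction k) (simp_all del: euler_frobenius.simps(2) add: coeff_euler_frobenius_Suc_0)

lemma coeff_euler_frobenius_gt: "s > k \<Longrightarrow> coeff (euler_frobenius k) s = 0"
proof (induction k arbitrary: s)
  case (Suc k)
  then obtain t where "s = Suc t" "t > k"
    by (cases s) auto
  with Suc.IH show ?case
    by (simp only: coeff_euler_frobenius_Suc_Suc)
qed simp

lemma coeff_euler_frobenius_self: "coeff (euler_frobenius k) k = 1"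
proof (induction k)
  case (Suc k)
  then show ?case
    by (simp only: coeff_euler_frobenius_Suc_Suc coeff_euler_frobenius_gt[OF lessI]) simp
qed simp

lemma degree_euler_frobenius: "degree (euler_frobenius k) = k"
  by (rule antisym) (auto intro!: degree_le le_degree simp: coeff_euler_frobenius_gt coeff_euler_frobenius_self)

text \<open>Reflecting the index interchanges the two weights of the triangle recurrence, so the
  symmetry is inherited from row to row; the two end coefficients are both 1. The symmetry later
  pairs exponentials into cosines.\<close>

lemma coeff_euler_frobenius_sym:
  "s \<le> k \<Longrightarrow> coeff (euler_frobenius k) (k - s) = coeff (euler_frobenius k) s"
proof (induction k arbitrary: s)
  case (Suc k)
  consider "s = 0" | "s = Suc k" | t where "s = Suc t" "t < k"
    using Suc.prems by (cases s) (auto simp: le_less)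
  then show ?case
  proof cases
    case 3
    then have "Suc k - s = Suc (k - s)" "s \<le> k" "k - t = Suc (k - s)"
      by auto
    moreover have "real k + 1 - real (k - s) = real s + 1"
      using \<open>s \<le> k\<close> by (simp add: of_nat_diff)
    ultimately show ?thesis
      using Suc.IH[of s] Suc.IH[of t] 3 
      by (simp del: euler_frobenius.simps
          add: coeff_euler_frobenius_Suc_Suc algebra_simps)
  qed (simp_all only: diff_zero diff_self_eq_0 coeff_euler_frobenius_0 coeff_euler_frobenius_self)
qed simp

lemma theta_op_funpow:
  assumes "x \<noteq> 1"
  shows "(theta_op ^^ k) (\<lambda>t. t / (1 - t)\<^sup>2) x = x * poly (euler_frobenius k) x / (1 - x) ^ (k + 2)"
  using assms
proof (induction k arbitrary: x)
  case (Suc k)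
  let ?E = "pCons 0 (euler_frobenius k)"
  have "((\<lambda>t. poly ?E t / (1 - t) ^ (k + 2)) has_field_derivative
      poly (euler_frobenius (Suc k)) x / (1 - x) ^ (k + 3)) (at x)"
  proof -
    have "((\<lambda>t. poly ?E t / (1 - t) ^ (k + 2)) has_field_derivative
      (poly (pderiv ?E) x * (1 - x) ^ (k + 2) + poly ?E x * (real (k + 2) * (1 - x) ^ (k + 1)))
        / ((1 - x) ^ (k + 2) * (1 - x) ^ (k + 2))) (at x)"
    proof -
      have "((\<lambda>t. (1 - t) ^ (k + 2)) has_field_derivative - (real (k + 2) * (1 - x) ^ (k + 1))) (at x)"
        by (rule derivative_eq_intros refl)+ simp
      from DERIV_divide[OF poly_DERIV[of ?E x] this] Suc.prems show ?thesis
        by simp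
    qed
    also have "(poly (pderiv ?E) x * (1 - x) ^ (k + 2) + poly ?E x * (real (k + 2) * (1 - x) ^ (k + 1)))
        / ((1 - x) ^ (k + 2) * (1 - x) ^ (k + 2))
        = poly (euler_frobenius (Suc k)) x / (1 - x) ^ (k + 3)"
    proof -
      have "(P * y ^ (k + 2) + Q * (c * y ^ (k + 1))) / (y ^ (k + 2) * y ^ (k + 2))
          = (y * P + c * Q) / y ^ (k + 3)" if "y \<noteq> 0" for P Q c y :: real
        using that by (simp add: divide_simps power_add eval_nat_numeral) (simp add: algebra_simps)
      from this[of "1 - x" "poly (pderiv ?E) x" "poly ?E x" "real (k + 2)"] Suc.prems
      show ?thesis by (simp add: algebra_simps)
    qed
    finally show ?thesis .
  qed
  \<comment> \<open>The induction hypothesis is a pointwise equality off 1. That set is open, so the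
    equality carries over to derivatives.\<close>
  then have "((theta_op ^^ k) (\<lambda>t. t / (1 - t)\<^sup>2) has_field_derivative
      poly (euler_frobenius (Suc k)) x / (1 - x) ^ (k + 3)) (at x)"
    by (rule has_field_derivative_transform_within_open[where S = "- {1}"])
      (use Suc in auto)
  then have "deriv ((theta_op ^^ k) (\<lambda>t. t / (1 - t)\<^sup>2)) x
      = poly (euler_frobenius (Suc k)) x / (1 - x) ^ (k + 3)"
    by (rule DERIV_imp_deriv)
  then show ?case
    by (simp del: euler_frobenius.simps add: theta_op_def[of "(theta_op ^^ k) _"] eval_nat_numeral)
qed (simp add: power2_eq_square)

lemma euler_poly_eq_euler_frobenius: "euler_poly k = euler_frobenius k"
  unfolding euler_poly_def
proof (rule the_equality)
  show "degree (euler_frobenius k) = k \<and> (\<forall>x. x \<noteq> 1 \<longrightarrow> x * poly (euler_frobenius k) x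
      = (1 - x) ^ (k + 2) * (theta_op ^^ k) (\<lambda>t. t / (1 - t)\<^sup>2) x)"
    by (simp add: degree_euler_frobenius theta_op_funpow)
next
  fix P
  assume P: "degree P = k \<and> (\<forall>x. x \<noteq> 1 \<longrightarrow> x * poly P x
      = (1 - x) ^ (k + 2) * (theta_op ^^ k) (\<lambda>t. t / (1 - t)\<^sup>2) x)"
  \<comment> \<open>The half-line avoids 1, where the defining identity says nothing, and 0, where
    the factor x cannot be cancelled. Being infinite, it still determines the polynomial.\<close>
  have "poly P x = poly (euler_frobenius k) x" if "x \<in> {2..}" for x
  proof -
    have "x * poly P x = (1 - x) ^ (k + 2) * (theta_op ^^ k) (\<lambda>t. t / (1 - t)\<^sup>2) x"
      using P that by auto
    then show ?thesis
      using that by (simp add: theta_op_funpow)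
  qed
  then have "{2..} \<subseteq> {x. poly (P - euler_frobenius k) x = 0}"
    by auto
  then have "infinite {x. poly (P - euler_frobenius k) x = 0}"
    using infinite_Ici[of "2 :: real"] finite_subset by blast
  then show "P = euler_frobenius k"
    using poly_roots_finite[of "P - euler_frobenius k"] by auto
qed

section \<open>Explicit coefficients from a generating function\<close>

text \<open>Multiplying by X and differentiating turns the coefficient (n + 1)^(k + 1) into (n +
  1)^(k + 2). The product rule with the derivative of (1 - X)^(k + 2) then reproduces the recurrence
  of \<open>euler_frobenius\<close>; the base case is the series of 1 / (1 - X)^2.\<close>

lemma fps_of_euler_frobenius:
  "fps_of_poly (euler_frobenius k) = (1 - fps_X) ^ (k + 2) * Abs_fps (\<lambda>n. (real n + 1) ^ (k + 1))"
proof (induction k)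
  case 0
  have "inverse ((1 - fps_X)\<^sup>2 :: real fps) = Abs_fps (\<lambda>n. real n + 1)"
    by (simp add: fps_one_over_one_minus_fps_X_squared add.commute)
  moreover have "(1 - fps_X)\<^sup>2 * inverse ((1 - fps_X)\<^sup>2 :: real fps) = 1"
    by (rule inverse_mult_eq_1') (simp add: fps_nth_power_0)
  ultimately show ?case
    by (simp add: numeral_2_eq_2)
next
  case (Suc k)
  define F where "F = (\<lambda>k. Abs_fps (\<lambda>n. (real n + 1) ^ (k + 1)))"
  define Y :: "real fps" where "Y = 1 - fps_X"
  define c where "c = fps_const (real (k + 2))"
  have F_Suc: "F (Suc k) = fps_deriv (fps_X * F k)"
    by (rule fps_ext) (simp add: F_def algebra_simps)
  have E: "fps_X * fps_of_poly (euler_frobenius k) = Y ^ (k + 2) * (fps_X * F k)"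
    using Suc.IH by (simp add: F_def Y_def mult_ac)
  have Y: "fps_deriv (Y ^ (k + 2)) = - c * Y ^ (k + 1)"
  proof -
    have "fps_deriv Y = - 1"
      by (simp add: Y_def)
    then show ?thesis
      unfolding fps_deriv_power c_def by (simp flip: fps_const_neg)
  qed
  have "fps_of_poly (euler_frobenius (Suc k))
      = Y * fps_deriv (fps_X * fps_of_poly (euler_frobenius k))
        + c * (fps_X * fps_of_poly (euler_frobenius k))"
  proof -
    have "fps_X * fps_of_poly (euler_frobenius k) = fps_of_poly (pCons 0 (euler_frobenius k))"
      by (simp add: fps_of_poly_pCons mult.commute)
    moreover have "Y = fps_of_poly [:1, -1:]"
      by (simp add: Y_def fps_of_poly_pCons)
    ultimately show ?thesis
      by (simp only: euler_frobenius.simps fps_of_poly_add fps_of_poly_mult fps_of_poly_smult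
          fps_of_poly_pderiv c_def)
  qed
  also have "\<dots> = Y ^ (Suc k + 2) * F (Suc k)"
    unfolding E F_Suc fps_deriv_mult Y by (simp add: algebra_simps)
  finally show ?case
    by (simp add: F_def Y_def)
qed

text \<open>The Cauchy product of the binomial expansion of (1 - X)^(k + 2) with the power series.
  It holds for every s, so above the degree it yields vanishing alternating sums.\<close>

lemma coeff_euler_frobenius:
  "coeff (euler_frobenius k) s
     = (\<Sum>j\<le>s. (-1) ^ j * real ((k + 2) choose j) * (real s + 1 - real j) ^ (k + 1))"
proof -
  have c: "fps_nth ((1 - fps_X) ^ n) j = (-1) ^ j * real (n choose j)" for n j
  proof -
    have "(1 - fps_X) ^ n = fps_of_poly ([:1, -1:] ^ n :: real poly)"
      by (simp add: fps_of_poly_power fps_of_poly_pCons)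
    then have "fps_nth ((1 - fps_X) ^ n) j = coeff ([:1, -1:] ^ n :: real poly) j"
      by (simp only: fps_of_poly_nth)
    then show ?thesis
      by (cases "j \<le> n")
        (simp_all add: coeff_linear_poly_power coeff_eq_0 degree_power_eq binomial_eq_0)
  qed
  have "coeff (euler_frobenius k) s = fps_nth (fps_of_poly (euler_frobenius k)) s"
    by simp
  also have "\<dots> = (\<Sum>j=0..s. (-1) ^ j * real ((k + 2) choose j) * (real (s - j) + 1) ^ (k + 1))"
    unfolding fps_of_euler_frobenius fps_mult_nth c by simp
  finally show ?thesis
    by (simp add: atMost_atLeast0 of_nat_diff algebra_simps)
qed

section \<open>The central difference of the kernel\<close>

text \<open>A difference of order k + 2 annihilates a polynomial of degree k + 1. Here this comes
  from the degree of the Euler polynomial: as a polynomial in x the sum has infinitely many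
  zeros.\<close>

lemma sum_binomial_alternating_power_eq_0:
  fixes x :: real
  shows "(\<Sum>j\<le>k + 2. (-1) ^ j * real ((k + 2) choose j) * (x - real j) ^ (k + 1)) = 0"
proof -
  define q where
    "q = (\<Sum>j\<le>k + 2. smult ((-1) ^ j * real ((k + 2) choose j)) ([:- real j, 1:] ^ (k + 1)))"
  have poly_q: "poly q y = (\<Sum>j\<le>k + 2. (-1) ^ j * real ((k + 2) choose j) * (y - real j) ^ (k + 1))" for y
    unfolding q_def poly_sum poly_smult poly_power by simp
  (* At an integer s + 1 >= k + 3 the sum is a coefficient of the Euler polynomial of index above its degree. *)
  have "poly q (real s + 1) = 0" if "s \<ge> k + 2" for s
  proof -
    have "poly q (real s + 1) = coeff (euler_frobenius k) s"
      unfolding poly_q coeff_euler_frobenius using that by (intro sum.mono_neutral_left) auto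
    then show ?thesis
      using that by (simp add: coeff_euler_frobenius_gt)
  qed
  then have "(\<lambda>s. real s + 1) ` {k + 2..} \<subseteq> {y. poly q y = 0}"
    by auto
  moreover have "infinite ((\<lambda>s. real s + 1) ` {k + 2..})"
    by (subst finite_image_iff) (auto simp: inj_on_def infinite_Ici)
  ultimately have "infinite {y. poly q y = 0}"
    using finite_subset by blast
  then have "q = 0"
    using poly_roots_finite by blast
  with poly_q[of x] show ?thesis
    by simp
qed

text \<open>Differencing a truncated power cuts the alternating sum off where its argument turns
  nonpositive, and the partial sum that remains is the explicit formula for an Euler
  coefficient.\<close>

lemma discrete_G_central_difference:
  assumes "m \<ge> 1" "h > 0"
  shows "(\<Sum>j\<le>2 * m. (-1) ^ j * real ((2 * m) choose j) * discrete_G m h (t + int m - int j))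
    = h ^ (2 * m - 1) / fact (2 * m - 1) *
      (\<Sum>s\<le>2 * m - 2. coeff (euler_frobenius (2 * m - 2)) s * discrete_delta (t + int m - 1 - int s))"
proof -
  define k where "k = 2 * m - 2"
  have k: "2 * m = k + 2" "2 * m - 1 = k + 1" "2 * m - 2 = k"
    using assms by (auto simp: k_def)
  define c where "c = (\<lambda>j. (-1) ^ j * real ((k + 2) choose j))"
  define r where "r = t + int m"
  define K where "K = h ^ (k + 1) / fact (k + 1)"
  (* x^(k+1) sgn x / 2 is the truncated power minus x^(k+1) / 2, which the difference annihilates. *)
  have G: "discrete_G m h b
      = K * (if b > 0 then of_int b ^ (k + 1) else 0) - K * of_int b ^ (k + 1) / 2" for b
  proof -
    have "sgn (h * of_int b) = sgn (real_of_int b)"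
      using assms by (simp add: sgn_mult)
    then show ?thesis
      unfolding discrete_G_def k(2) K_def power_mult_distrib
      by (cases b "0 :: int" rule: linorder_cases)
        (simp_all add: field_simps del: fact_Suc power_Suc)
  qed
  have "(\<Sum>j\<le>k + 2. c j * discrete_G m h (r - int j))
      = K * (\<Sum>j\<le>k + 2. c j * (if r - int j > 0 then of_int (r - int j) ^ (k + 1) else 0))
        - K / 2 * (\<Sum>j\<le>k + 2. c j * of_int (r - int j) ^ (k + 1))"
    unfolding G sum_distrib_left sum_subtractf[symmetric]
    by (intro sum.cong refl) (simp add: right_diff_distrib mult_ac del: power_Suc of_int_diff)
  also have "(\<Sum>j\<le>k + 2. c j * of_int (r - int j) ^ (k + 1)) = 0"
    using sum_binomial_alternating_power_eq_0[of k "of_int r"] by (simp add: c_def)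
  also have "(\<Sum>j\<le>k + 2. c j * (if r - int j > 0 then of_int (r - int j) ^ (k + 1) else 0))
      = (\<Sum>s\<le>k. coeff (euler_frobenius k) s * discrete_delta (r - 1 - int s))"
  proof (cases "r > 0")
    case False
    then show ?thesis
      by (intro trans[OF sum.neutral sum.neutral[symmetric]]) (auto simp: discrete_delta_def)
  next
    case True
    \<comment> \<open>The surviving terms are those with j < r, that is j \<le> r - 1, hence this
      index.\<close>
    define s where "s = nat (r - 1)"
    have r: "r = int s + 1"
      using True by (simp add: s_def)
    have "(\<Sum>j\<le>k + 2. c j * (if r - int j > 0 then of_int (r - int j) ^ (k + 1) else 0))
        = (\<Sum>j\<in>{..k + 2} \<inter> {..s}. c j * (real s + 1 - real j) ^ (k + 1))"
      by (intro sum.mono_neutral_cong_right) (auto simp: r)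
    \<comment> \<open>Terms with k + 2 < j \<le> s may be added freely, since their binomials are
      zero.\<close>
    also have "\<dots> = coeff (euler_frobenius k) s"
      unfolding coeff_euler_frobenius c_def by (intro sum.mono_neutral_left) (auto simp: binomial_eq_0)
    \<comment> \<open>For s > k no index matches, in agreement with a zero coefficient above the
      degree.\<close>
    also have "\<dots> = (\<Sum>s'\<le>k. if s' = s then coeff (euler_frobenius k) s else 0)"
      by (auto simp: coeff_euler_frobenius_gt)
    also have "\<dots> = (\<Sum>s'\<le>k. coeff (euler_frobenius k) s' * discrete_delta (r - 1 - int s'))"
      by (intro sum.cong) (auto simp: discrete_delta_def r)
    finally show ?thesis .
  qed
  finally show ?thesis
    unfolding k(2,3) unfolding k(1) by (simp only: c_def K_def r_def mult_zero_right diff_zero)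
qed

section \<open>From the convolution equation to a finite difference equation\<close>

lemma has_sum_sum_fun:
  fixes f :: "'b \<Rightarrow> 'a \<Rightarrow> 'c :: topological_comm_monoid_add"
  assumes "\<And>i. i \<in> I \<Longrightarrow> (f i has_sum s i) A"
  shows "((\<lambda>x. \<Sum>i\<in>I. f i x) has_sum (\<Sum>i\<in>I. s i)) A"
  using assms by (induction I rule: infinite_finite_induct) (auto intro: has_sum_add)

text \<open>The sifting property. It serves both real sequences and complex exponentials, hence the
  general algebra.\<close>

lemma has_sum_discrete_delta:
  fixes f :: "int \<Rightarrow> 'a :: real_normed_algebra_1"
  shows "((\<lambda>\<gamma>. f \<gamma> * of_real (discrete_delta (c - \<gamma>))) has_sum f c) UNIV"
  by (rule has_sum_finite_neutralI[of "{c}"]) (auto simp: discrete_delta_def)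

lemma discrete_analogue_summable:
  assumes "m \<ge> 1" "h > 0" "discrete_analogue m h D"
  shows "(\<lambda>\<gamma>. \<bar>D \<gamma>\<bar>) summable_on UNIV"
proof -
  \<comment> \<open>This is the absolute value of \<open>discrete_G\<close> at 1 and -1, its minimum
    off the origin.\<close>
  define K where "K = h ^ (2 * m - 1) / (2 * fact (2 * m - 1))"
  have K: "K > 0"
    using assms by (simp add: K_def)
  have "(\<lambda>\<gamma>. \<bar>D \<gamma> * discrete_G m h (0 - \<gamma>)\<bar> / K) summable_on UNIV"
    unfolding divide_inverse
    by (rule summable_on_cmult_left) (use assms(3) in \<open>unfold discrete_analogue_def, blast\<close>)
  then have "(\<lambda>\<gamma>. \<bar>D \<gamma> * discrete_G m h (0 - \<gamma>)\<bar> / K) summable_on (- {0})"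
    by (rule summable_on_subset) auto
  then have "(\<lambda>\<gamma>. norm (D \<gamma>)) summable_on (- {0})"
  proof (rule summable_on_comparison_test)
    fix \<gamma> :: int
    assume "\<gamma> \<in> - {0}"
    then have "1 \<le> \<bar>real_of_int \<gamma>\<bar> ^ (2 * m - 1)"
      by (intro one_le_power) auto
    then have "K \<le> \<bar>discrete_G m h (0 - \<gamma>)\<bar>"
      using assms \<open>\<gamma> \<in> - {0}\<close>
      by (auto simp: discrete_G_def K_def abs_mult power_abs power_mult_distrib abs_sgn_eq divide_right_mono)
    then have "\<bar>D \<gamma>\<bar> * K \<le> \<bar>D \<gamma>\<bar> * \<bar>discrete_G m h (0 - \<gamma>)\<bar>"
      by (intro mult_left_mono) auto
    with K show "norm (D \<gamma>) \<le> \<bar>D \<gamma> * discrete_G m h (0 - \<gamma>)\<bar> / K"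
      by (simp add: field_simps abs_mult)
  qed simp
  \<comment> \<open>The kernel vanishes at 0 and gives no bound there, but a single point does not
    affect summability.\<close>
  then have "(\<lambda>\<gamma>. \<bar>D \<gamma>\<bar>) summable_on insert 0 (- {0})"
    by (simp only: summable_on_insert_iff real_norm_def)
  moreover have "insert (0 :: int) (- {0}) = UNIV"
    by auto
  ultimately show ?thesis
    by metis
qed

text \<open>The central difference in \<beta> is a finite combination, so it passes inside the
  convergent convolution series and falls on \<open>discrete_G\<close> alone, where it leaves
  finitely many deltas. The right-hand side is the same difference of
  \<open>discrete_delta\<close>.\<close>

lemma discrete_analogue_difference_equation:
  assumes "m \<ge> 1" "h > 0" "discrete_analogue m h D"
  shows "h * (h ^ (2 * m - 1) / fact (2 * m - 1)) *
      (\<Sum>s\<le>2 * m - 2. coeff (euler_frobenius (2 * m - 2)) s * D (\<beta> + int m - 1 - int s))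
    = (\<Sum>j\<le>2 * m. (-1) ^ j * real ((2 * m) choose j) * discrete_delta (\<beta> + int m - int j))"
proof -
  define c where "c = (\<lambda>j. (-1) ^ j * real ((2 * m) choose j))"
  define K where "K = h ^ (2 * m - 1) / fact (2 * m - 1)"
  define E where "E = coeff (euler_frobenius (2 * m - 2))"
  have "((\<lambda>\<gamma>. D \<gamma> * discrete_G m h (b - \<gamma>)) has_sum discrete_conv D (discrete_G m h) b) UNIV" for b
  proof -
    have "(\<lambda>\<gamma>. D \<gamma> * discrete_G m h (b - \<gamma>)) summable_on UNIV"
      by (rule abs_summable_summable) (use assms(3) in \<open>simp add: discrete_analogue_def\<close>)
    then show ?thesis
      by (simp add: discrete_conv_def)
  qed
  then have "((\<lambda>\<gamma>. \<Sum>j\<le>2 * m. c j * (D \<gamma> * discrete_G m h (\<beta> + int m - int j - \<gamma>)))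
      has_sum (\<Sum>j\<le>2 * m. c j * discrete_conv D (discrete_G m h) (\<beta> + int m - int j))) UNIV"
    by (intro has_sum_sum_fun has_sum_cmult_right)
  moreover have "(\<Sum>j\<le>2 * m. c j * (D \<gamma> * discrete_G m h (\<beta> + int m - int j - \<gamma>)))
      = (\<Sum>s\<le>2 * m - 2. K * E s * (D \<gamma> * of_real (discrete_delta (\<beta> + int m - 1 - int s - \<gamma>))))"
    (is "?l \<gamma> = ?r \<gamma>") for \<gamma>
  proof -
    have "?l \<gamma> = D \<gamma> * (\<Sum>j\<le>2 * m. c j * discrete_G m h (\<beta> - \<gamma> + int m - int j))"
      by (simp add: sum_distrib_left algebra_simps)
    also have "\<dots> = ?r \<gamma>"
      unfolding c_def discrete_G_central_difference[OF assms(1,2)]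
      by (simp add: sum_distrib_left K_def E_def algebra_simps)
    finally show ?thesis .
  qed
  ultimately have lhs: "((\<lambda>\<gamma>. \<Sum>s\<le>2 * m - 2. K * E s * (D \<gamma> * of_real (discrete_delta (\<beta> + int m - 1 - int s - \<gamma>))))
      has_sum (\<Sum>j\<le>2 * m. c j * discrete_conv D (discrete_G m h) (\<beta> + int m - int j))) UNIV"
    by simp
  \<comment> \<open>The deltas collapse the same series to finitely many values of \<open>D\<close>;
    uniqueness of the sum equates this with the value in \<open>lhs\<close>.\<close>
  have rhs: "((\<lambda>\<gamma>. \<Sum>s\<le>2 * m - 2. K * E s * (D \<gamma> * of_real (discrete_delta (\<beta> + int m - 1 - int s - \<gamma>))))
      has_sum (\<Sum>s\<le>2 * m - 2. K * E s * D (\<beta> + int m - 1 - int s))) UNIV"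
    by (intro has_sum_sum_fun has_sum_cmult_right has_sum_discrete_delta)
  have "h * (\<Sum>s\<le>2 * m - 2. K * E s * D (\<beta> + int m - 1 - int s))
      = h * (\<Sum>j\<le>2 * m. c j * discrete_conv D (discrete_G m h) (\<beta> + int m - int j))"
    using has_sum_unique[OF rhs lhs] by simp
  also have "\<dots> = (\<Sum>j\<le>2 * m. c j * (h * discrete_conv D (discrete_G m h) (\<beta> + int m - int j)))"
    by (simp add: sum_distrib_left mult_ac)
  also have "\<dots> = (\<Sum>j\<le>2 * m. c j * discrete_delta (\<beta> + int m - int j))"
    using assms(3) by (simp add: discrete_analogue_def)
  finally show ?thesis
    by (simp add: c_def K_def E_def sum_distrib_left mult_ac)
qed

section \<open>Fourier series of the difference equation\<close>

text \<open>Stated as a product, because the nonvanishing of the factor beside S is afterwards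
  deduced from this identity.\<close>

lemma discrete_analogue_fourier:
  fixes \<theta> :: real
  assumes "m \<ge> 1" "h > 0" "discrete_analogue m h D"
    and S: "((\<lambda>\<beta>. complex_of_real (D \<beta>) * cis (\<theta> * of_int \<beta>)) has_sum S) UNIV"
  shows "of_real (h * (h ^ (2 * m - 1) / fact (2 * m - 1))) *
      (\<Sum>s\<le>2 * m - 2. of_real (coeff (euler_frobenius (2 * m - 2)) s) * cis (\<theta> * (real s + 1 - real m))) * S
    = of_real ((-1) ^ m * 2 ^ (2 * m) * sin (\<theta> / 2) ^ (2 * m))"
proof -
  define c :: "nat \<Rightarrow> real" where "c = (\<lambda>j. (-1) ^ j * real ((2 * m) choose j))"
  define K where "K = h * (h ^ (2 * m - 1) / fact (2 * m - 1))"
  define E where "E = coeff (euler_frobenius (2 * m - 2))"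
  define e where "e = (\<lambda>\<beta>::int. cis (\<theta> * of_int \<beta>))"
  have e_add: "e (a + b) = e a * e b" for a b
    by (simp add: e_def cis_mult ring_distribs)
  \<comment> \<open>A translation of the lattice becomes multiplication by a character.\<close>
  have shift: "((\<lambda>\<beta>. of_real (D (\<beta> - b)) * e \<beta>) has_sum e b * S) UNIV" for b
  proof -
    have "bij_betw (\<lambda>\<beta>::int. \<beta> - b) UNIV UNIV"
      by (rule bij_betwI[of _ _ _ "\<lambda>\<beta>. \<beta> + b"]) auto
    from has_sum_reindex_bij_betw[OF this, of "\<lambda>\<beta>. of_real (D \<beta>) * e \<beta>" S]
    have "((\<lambda>\<beta>. of_real (D (\<beta> - b)) * e (\<beta> - b)) has_sum S) UNIV"
      using S by (simp add: e_def)
    then have "((\<lambda>\<beta>. e b * (of_real (D (\<beta> - b)) * e (\<beta> - b))) has_sum e b * S) UNIV"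
      by (rule has_sum_cmult_right)
    moreover have "e b * (of_real (D (\<beta> - b)) * e (\<beta> - b)) = of_real (D (\<beta> - b)) * e \<beta>" for \<beta>
      by (subst mult.left_commute, subst e_add[symmetric]) simp
    ultimately show ?thesis
      by (simp only:)
  qed
  have lhs: "((\<lambda>\<beta>. \<Sum>s\<le>2 * m - 2. of_real (K * E s) * (of_real (D (\<beta> - (int s + 1 - int m))) * e \<beta>))
      has_sum (\<Sum>s\<le>2 * m - 2. of_real (K * E s) * (e (int s + 1 - int m) * S))) UNIV"
    by (intro has_sum_sum_fun has_sum_cmult_right shift)
  have eq: "(\<Sum>s\<le>2 * m - 2. of_real (K * E s) * (of_real (D (\<beta> - (int s + 1 - int m))) * e \<beta>))
      = (\<Sum>j\<le>2 * m. of_real (c j) * (e \<beta> * of_real (discrete_delta (int j - int m - \<beta>))))"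
    (is "?l = ?r") for \<beta>
  proof -
    have "?l = of_real (K * (\<Sum>s\<le>2 * m - 2. E s * D (\<beta> + int m - 1 - int s))) * e \<beta>"
      by (simp add: sum_distrib_left sum_distrib_right algebra_simps)
    \<comment> \<open>Evenness of \<open>discrete_delta\<close> allows its argument to be reversed
      into the form required by the sifting property.\<close>
    also have "K * (\<Sum>s\<le>2 * m - 2. E s * D (\<beta> + int m - 1 - int s))
        = (\<Sum>j\<le>2 * m. c j * discrete_delta (int j - int m - \<beta>))"
      unfolding K_def E_def c_def discrete_analogue_difference_equation[OF assms(1-3)]
      by (intro sum.cong) (auto simp: discrete_delta_def)
    also have "of_real \<dots> * e \<beta> = ?r"
      by (simp add: sum_distrib_left sum_distrib_right algebra_simps)
    finally show ?thesis .
  qed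
  have rhs: "((\<lambda>\<beta>. \<Sum>j\<le>2 * m. of_real (c j) * (e \<beta> * of_real (discrete_delta (int j - int m - \<beta>))))
      has_sum (\<Sum>j\<le>2 * m. of_real (c j) * e (int j - int m))) UNIV"
    by (intro has_sum_sum_fun has_sum_cmult_right has_sum_discrete_delta)
  have "(\<Sum>s\<le>2 * m - 2. of_real (K * E s) * (e (int s + 1 - int m) * S))
      = (\<Sum>j\<le>2 * m. of_real (c j) * e (int j - int m))"
    by (rule has_sum_unique[OF lhs[unfolded eq] rhs])
  also have "\<dots> = of_real ((-1) ^ m * 2 ^ (2 * m) * sin (\<theta> / 2) ^ (2 * m))"
  proof -
    have e_diff: "e (int j - int m) = e (- int m) * cis \<theta> ^ j" for j
    proof -
      have "e (int j) = cis \<theta> ^ j"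
        by (simp only: e_def Complex.DeMoivre of_int_of_nat_eq mult.commute)
      with e_add[of "- int m" "int j"] show ?thesis
        by simp
    qed
    \<comment> \<open>With z = \<open>cis \<theta>\<close>, the binomial theorem sums the difference
      stencil to z^(-m) (1 - z)^(2m).\<close>
    have "(\<Sum>j\<le>2 * m. of_real (c j) * e (int j - int m))
        = e (- int m) * (\<Sum>j\<le>2 * m. of_nat ((2 * m) choose j) * (- cis \<theta>) ^ j * 1 ^ (2 * m - j))"
      unfolding e_diff sum_distrib_left
      by (intro sum.cong) (simp_all add: c_def power_minus[of "cis \<theta>"] mult_ac)
    also have "\<dots> = e (- int m) * (1 - cis \<theta>) ^ (2 * m)"
      by (subst binomial_ring[symmetric]) simp
    \<comment> \<open>Splitting into m equal factors makes each one real: (1 - z)^2 / z = z + 1/z -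
      2 = -4 sin^2(\<theta>/2).\<close>
    also have "\<dots> = (cis (- \<theta>) * (1 - cis \<theta>)\<^sup>2) ^ m"
    proof -
      have "e (- int m) = cis (- \<theta>) ^ m"
        by (simp only: e_def Complex.DeMoivre of_int_of_nat_eq of_int_minus mult_minus_left mult_minus_right
            mult.commute)
      then show ?thesis
        by (simp only: power_mult power_mult_distrib)
    qed
    also have "cis (- \<theta>) * (1 - cis \<theta>)\<^sup>2 = cis (- \<theta>) + cis \<theta> - 2"
    proof -
      have "w * (1 - z)\<^sup>2 = w - 2 * (w * z) + (w * z) * z" for w z :: complex
        by (simp add: power2_eq_square algebra_simps)
      from this[of "cis (- \<theta>)" "cis \<theta>"] show ?thesis
        by (simp add: cis_mult)
    qed
    also have "\<dots> = of_real (2 * cos \<theta> - 2)"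
      by (simp add: complex_eq_iff)
    also have "2 * cos \<theta> - 2 = (-1) * 2\<^sup>2 * (sin (\<theta> / 2))\<^sup>2"
      using cos_double_sin[of "\<theta> / 2"] by simp
    also have "of_real \<dots> ^ m = (of_real ((-1) ^ m * 2 ^ (2 * m) * sin (\<theta> / 2) ^ (2 * m)) :: complex)"
      by (simp only: power_mult power_mult_distrib of_real_mult of_real_power)
    finally show ?thesis .
  qed
  finally show ?thesis
    by (simp add: K_def E_def e_def sum_distrib_left sum_distrib_right mult_ac)
qed

section \<open>The denominator as a cosine polynomial\<close>

lemma sum_atMost_double_pair:
  "(\<Sum>s\<le>2 * n. f s) = (\<Sum>s<n. f s + f (2 * n - s)) + f (n :: nat)"
  for f :: "nat \<Rightarrow> 'a :: comm_monoid_add"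
proof -
  have "(\<Sum>s\<le>2 * n. f s) = (\<Sum>s\<in>{..<n} \<union> {n<..2 * n} \<union> {n}. f s)"
    by (intro sum.cong) auto
  also have "\<dots> = (\<Sum>s<n. f s) + (\<Sum>s\<in>{n<..2 * n}. f s) + f n"
    by (subst sum.union_disjoint; auto)+
  also have "(\<Sum>s\<in>{n<..2 * n}. f s) = (\<Sum>s<n. f (2 * n - s))"
    by (rule sum.reindex_bij_witness[of _ "\<lambda>s. 2 * n - s" "\<lambda>s. 2 * n - s"]) auto
  finally show ?thesis
    by (simp add: sum.distrib)
qed

text \<open>The indices s and 2n - s carry equal coefficients and conjugate exponentials, so each
  pair adds up to a cosine and the middle term stands alone. It is applied with n = m - 1.\<close>

lemma sum_euler_frobenius_cis:
  fixes n :: nat and \<theta> :: real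
  defines "E \<equiv> coeff (euler_frobenius (2 * n))"
  shows "(\<Sum>s\<le>2 * n. of_real (E s) * cis (\<theta> * (real s - real n)))
    = of_real (2 * (\<Sum>s<n. E s * cos (\<theta> * (real n - real s))) + E n)"
proof -
  have "of_real (E s) * cis (\<theta> * (real s - real n))
      + of_real (E (2 * n - s)) * cis (\<theta> * (real (2 * n - s) - real n))
      = of_real (2 * (E s * cos (\<theta> * (real n - real s))))" if "s < n" for s
  proof -
    have "E (2 * n - s) = E s"
      using that by (simp add: E_def coeff_euler_frobenius_sym)
    moreover have "\<theta> * (real s - real n) = - (\<theta> * (real n - real s))"
      "\<theta> * (real (2 * n - s) - real n) = \<theta> * (real n - real s)"
      using that by (simp_all add: of_nat_diff algebra_simps)
    ultimately show ?thesis
      by (simp only: cis_cnj[symmetric]) (simp add: complex_eq_iff)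
  qed
  then show ?thesis
    unfolding sum_atMost_double_pair by (simp add: sum_distrib_left)
qed

section \<open>Solving for the Fourier series\<close>

theorem mainTheorem4:
  fixes m :: nat and h :: real and D :: "int \<Rightarrow> real" and a :: "nat \<Rightarrow> real"
  assumes "m \<ge> 1" and "h > 0" and "discrete_analogue m h D"
    and a: "\<And>k. a k =
      (\<Sum>j=0..k. (-1) ^ j * real ((2 * m) choose j) * (real k + 1 - real j) ^ (2 * m - 1))"
  shows "(\<forall>p::real.
     ((\<lambda>\<beta>::int. complex_of_real (D \<beta>) *
          exp (2 * complex_of_real pi * \<i> * complex_of_real h * complex_of_real p * of_int \<beta>))
      has_sum complex_of_real
        (((-1) ^ m * 2 ^ (2 * m) * fact (2 * m - 1) * h powi (- (2 * int m)) * sin (pi * h * p) ^ (2 * m))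
         / (2 * (\<Sum>k<m - 1. a k * cos (2 * pi * h * p * (real m - 1 - real k))) + a (m - 1)))) UNIV)
   \<and> euler_poly (2 * m - 2) = (\<Sum>k\<le>2 * m - 2. monom (a k) k)"
proof (intro conjI allI)
  \<comment> \<open>Since m \<ge> 1, writing 2m = k + 2 removes the truncated subtractions and
    matches the coefficient formula.\<close>
  define k where "k = 2 * m - 2"
  have k: "2 * m = k + 2" "2 * m - 1 = k + 1" "2 * m - 2 = k"
    using assms(1) by (auto simp: k_def)
  have a_eq: "a = coeff (euler_frobenius (2 * m - 2))"
    unfolding k(3) fun_eq_iff a coeff_euler_frobenius k(2) atMost_atLeast0 unfolding k(1) by simp
  show "euler_poly (2 * m - 2) = (\<Sum>k\<le>2 * m - 2. monom (a k) k)"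
    using poly_as_sum_of_monoms[of "euler_frobenius (2 * m - 2)"]
    by (simp add: euler_poly_eq_euler_frobenius a_eq degree_euler_frobenius)
  fix p :: real
  define \<theta> where "\<theta> = 2 * pi * h * p"
  define den where "den = 2 * (\<Sum>k<m - 1. a k * cos (\<theta> * (real m - 1 - real k))) + a (m - 1)"
  define K where "K = h * (h ^ (2 * m - 1) / fact (2 * m - 1))"
  define num where "num = (-1) ^ m * 2 ^ (2 * m) * sin (\<theta> / 2) ^ (2 * m)"
  have m: "2 * (m - 1) = 2 * m - 2" "real (m - 1) = real m - 1"
    using assms(1) by auto
  have den: "(\<Sum>s\<le>2 * m - 2. of_real (a s) * cis (\<theta> * (real s + 1 - real m))) = of_real den"
    using sum_euler_frobenius_cis[of "m - 1" \<theta>] unfolding m den_def a_eq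
    by (simp add: algebra_simps)
  define F where "F = (\<lambda>\<beta>::int. complex_of_real (D \<beta>) * cis (\<theta> * of_int \<beta>))"
  have "(\<lambda>\<beta>. norm (F \<beta>)) summable_on UNIV"
    using discrete_analogue_summable[OF assms(1-3)] by (simp add: F_def norm_mult)
  then have F: "(F has_sum infsum F UNIV) UNIV"
    using abs_summable_summable has_sum_infsum by blast
  have eq: "of_real (K * den) * infsum F UNIV = of_real num"
    using discrete_analogue_fourier[OF assms(1-3) F[unfolded F_def]] 
    by (simp only: K_def num_def of_real_mult den[symmetric] F_def a_eq)
  have K: "K = h ^ (2 * m) / fact (2 * m - 1)" "K \<noteq> 0"
    using assms(2) by (simp_all add: K_def k)
  have "den \<noteq> 0"
  proof (cases "sin (\<theta> / 2) = 0")
    case False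
    then have "num \<noteq> 0"
      by (simp add: num_def)
    with eq show ?thesis by auto
  next
    case True
    then obtain i :: int where i: "\<theta> / 2 = of_int i * pi"
      by (auto simp: sin_zero_iff_int2)
    \<comment> \<open>Here \<theta> is an integer multiple of 2 pi and the frequencies s + 1 - m are
      integers, so the denominator becomes the plain sum of the coefficients.\<close>
    have "cis (\<theta> * (real s + 1 - real m)) = 1" for s
    proof -
      have "\<theta> * (real s + 1 - real m) = 2 * pi * of_int (i * (int s + 1 - int m))"
        using i by (simp add: field_simps)
      then show ?thesis
        by (simp only: cis_multiple_2pi Ints_of_int)
    qed
    then have "of_real den = (\<Sum>s\<le>2 * m - 2. complex_of_real (a s))"
      using den by simp
    then have "den = (\<Sum>s\<le>2 * m - 2. a s)"
      by (simp only: of_real_sum[symmetric] of_real_eq_iff)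
    also have "\<dots> = poly (euler_frobenius (2 * m - 2)) 1"
      by (simp add: a_eq poly_altdef degree_euler_frobenius)
    finally show ?thesis
      by (simp add: poly_euler_frobenius_1)
  qed
  with eq K(2) have "infsum F UNIV = of_real (num / (K * den))"
    by (simp add: field_simps)
  also have "num / (K * den) = (-1) ^ m * 2 ^ (2 * m) * fact (2 * m - 1) * h powi (- (2 * int m))
      * sin (pi * h * p) ^ (2 * m) / den"
  proof -
    have "h powi (- (2 * int m)) = inverse (h ^ (2 * m))"
      by (simp add: power_int_def nat_mult_distrib power_inverse)
    moreover have "\<theta> / 2 = pi * h * p"
      by (simp add: \<theta>_def)
    ultimately show ?thesis
      unfolding num_def K(1) by (simp add: field_simps)
  qed
  finally have S: "infsum F UNIV = complex_of_real ((-1) ^ m * 2 ^ (2 * m) * fact (2 * m - 1)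
      * h powi (- (2 * int m)) * sin (pi * h * p) ^ (2 * m) / den)" .
  have "F = (\<lambda>\<beta>::int. complex_of_real (D \<beta>) *
      exp (2 * complex_of_real pi * \<i> * complex_of_real h * complex_of_real p * of_int \<beta>))"
    by (simp add: F_def cis_conv_exp \<theta>_def mult_ac)
  with F S show "((\<lambda>\<beta>::int. complex_of_real (D \<beta>) *
          exp (2 * complex_of_real pi * \<i> * complex_of_real h * complex_of_real p * of_int \<beta>))
      has_sum complex_of_real
        (((-1) ^ m * 2 ^ (2 * m) * fact (2 * m - 1) * h powi (- (2 * int m)) * sin (pi * h * p) ^ (2 * m))
         / (2 * (\<Sum>k<m - 1. a k * cos (2 * pi * h * p * (real m - 1 - real k))) + a (m - 1)))) UNIV"
    by (simp only: den_def \<theta>_def)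
qed

end
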